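(* Fix $0<c<1$. If $N_{DFL}(\epsilon) \leq 2^{\epsilon^{-c+o(1)}}$ as $\epsilon \to 0$, then $\delta_{TRL}(\epsilon) \geq 2^{-\epsilon^{-c/(1-c)+o(1)}}$ as $\epsilon \to 0$.
   Context: All graphs are finite and simple. For $\epsilon>0$, $\delta_{TRL}(\epsilon)$ denotes the largest $\delta>0$ such that every $n$-vertex graph with fewer than $\delta n^3$ triangles can be made triangle-free by deleting at most $\epsilon n^2$ edges (the triangle removal lemma guarantees that such $\delta>0$ exists). For $\epsilon>0$, $N_{DFL}(\epsilon)$ denotes the smallest nonnegative integer $N$ such that for every $n \ge N$, every $n$-vertex graph in which each edge lies in a unique triangle has at most $\epsilon n^2$ edges (such an $N$ exists for every $\epsilon>0$). Here $o(1)$ denotes a function of $\epsilon$ (for the fixed $c$) tending to $0$ as $\epsilon \to 0^+$; the $o(1)$ terms in the hypothesis and the conclusion may be different functions. *)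

theory Defs
  imports Complex_Main "HOL-Library.Ramsey" "HOL-Library.Extended_Nat" "HOL-Library.Extended_Real"
begin

text \<open>
  A finite simple graph is a finite vertex set together with a set of two-element subsets of it;
  \<open>[V]\<^bsup>k\<^esup>\<close> is the set of \<open>k\<close>-element subsets of \<open>V\<close>.
\<close>

definition simple_graph :: "'a set \<Rightarrow> 'a set set \<Rightarrow> bool" where
  "simple_graph V E \<longleftrightarrow> finite V \<and> E \<subseteq> [V]\<^bsup>2\<^esup>"

definition triangles :: "'a set \<Rightarrow> 'a set set \<Rightarrow> 'a set set" where
  "triangles V E = {T \<in> [V]\<^bsup>3\<^esup>. [T]\<^bsup>2\<^esup> \<subseteq> E}"

definition triangle_free :: "'a set \<Rightarrow> 'a set set \<Rightarrow> bool" where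
  "triangle_free V E \<longleftrightarrow> triangles V E = {}"

definition triangle_free_by_deleting :: "real \<Rightarrow> 'a set \<Rightarrow> 'a set set \<Rightarrow> bool" where
  "triangle_free_by_deleting m V E \<longleftrightarrow>
     (\<exists>D \<subseteq> E. real (card D) \<le> m \<and> triangle_free V (E - D))"

definition edges_in_unique_triangle :: "'a set \<Rightarrow> 'a set set \<Rightarrow> bool" where
  "edges_in_unique_triangle V E \<longleftrightarrow> (\<forall>e \<in> E. \<exists>!T. T \<in> triangles V E \<and> e \<subseteq> T)"

text \<open>
  Every finite graph is isomorphic to one whose vertices are natural numbers, so the quantifiers
  over all finite graphs below range over vertex sets of type \<open>nat set\<close>.
\<close>

definition removal_bound :: "real \<Rightarrow> real \<Rightarrow> bool" where
  "removal_bound \<epsilon> \<delta> \<longleftrightarrow>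
     (\<forall>n. \<forall>(V :: nat set) E. simple_graph V E \<longrightarrow> card V = n \<longrightarrow>
        real (card (triangles V E)) < \<delta> * real n ^ 3 \<longrightarrow>
        triangle_free_by_deleting (\<epsilon> * real n ^ 2) V E)"

text \<open>
  For large \<open>\<epsilon>\<close> every \<open>\<delta>\<close> is a removal bound and there is no largest one; then the value is
  unspecified. Only small \<open>\<epsilon>\<close> matter for the asymptotics.
\<close>

definition delta_TRL :: "real \<Rightarrow> real" where
  "delta_TRL \<epsilon> = (GREATEST \<delta>. 0 < \<delta> \<and> removal_bound \<epsilon> \<delta>)"

definition diamond_free_bound :: "real \<Rightarrow> nat \<Rightarrow> bool" where
  "diamond_free_bound \<epsilon> n \<longleftrightarrow>
     (\<forall>(V :: nat set) E. simple_graph V E \<longrightarrow> card V = n \<longrightarrow>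
        edges_in_unique_triangle V E \<longrightarrow> real (card E) \<le> \<epsilon> * real n ^ 2)"

text \<open>
  The least threshold is taken in \<open>enat\<close>, where \<open>\<infinity>\<close> qualifies vacuously. Hence the minimum is
  attained by definition, and it is the least natural number threshold whenever there is one
  (see the lemma), which is the case for every \<open>\<epsilon> > 0\<close>.
\<close>

definition N_DFL :: "real \<Rightarrow> enat" where
  "N_DFL \<epsilon> = (LEAST N. \<forall>n. N \<le> enat n \<longrightarrow> diamond_free_bound \<epsilon> n)"

lemma N_DFL_le_iff: "N_DFL \<epsilon> \<le> enat N \<longleftrightarrow> (\<forall>n \<ge> N. diamond_free_bound \<epsilon> n)"
proof
  have "\<forall>n. N_DFL \<epsilon> \<le> enat n \<longrightarrow> diamond_free_bound \<epsilon> n"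
    unfolding N_DFL_def by (rule LeastI[of _ \<infinity>]) simp
  then show "\<forall>n \<ge> N. diamond_free_bound \<epsilon> n" if "N_DFL \<epsilon> \<le> enat N"
    using that by (meson enat_ord_simps(1) order_trans)
  show "N_DFL \<epsilon> \<le> enat N" if "\<forall>n \<ge> N. diamond_free_bound \<epsilon> n"
    unfolding N_DFL_def using that by (intro Least_le) simp
qed

end

theory Submission
  imports Defs "HOL-Real_Asymp.Real_Asymp"
begin

text \<open>
  The codegree of an edge is the number of triangles that contain it. Consider a graph with \<open>n\<close>
  vertices all of whose codegrees are at most \<open>D\<close>, and sample about \<open>m = n/(8D)\<close> vertices. In the sample
  an edge is in less than one triangle on average, so a positive proportion of the sampled triangles
  share no edge with another one (\<open>card_triangles_of_small_codegree\<close>). These isolated triangles form a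
  graph in which each edge is in a unique triangle, so if such graphs on \<open>m\<close> vertices have at most
  \<open>\<epsilon>m\<^sup>2\<close> edges, then there are only \<open>O(\<epsilon>n\<^sup>3/m) = O(\<epsilon>n\<^sup>2D)\<close> triangles in the given graph, and hence only
  \<open>O(\<epsilon>n\<^sup>2)\<close> edges of codegree above \<open>D/2\<close>. Deleting these edges halves the maximum codegree.

  Now let \<open>m = 2\<^sup>k\<close>. The hypothesis on \<open>N\<^sub>D\<^sub>F\<^sub>L\<close> allows \<open>\<epsilon> = k\<^bsup>-p\<^esup>\<close> at this scale, for any \<open>p < 1/c\<close>.
  If the graph has fewer than \<open>4\<^bsup>-K\<^esup>n\<^sup>3\<close> triangles, then deleting \<open>O(2\<^bsup>-K\<^esup>n\<^sup>2)\<close> edges makes all codegrees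
  at most \<open>n/2\<^bsup>K+3\<^esup>\<close>, and the halving, run over all scales \<open>k \<ge> K\<close> until no triangle remains, deletes
  \<open>O(n\<^sup>2) \<Sum>\<^bsub>k\<ge>K\<^esub> k\<^bsup>-p\<^esup> = O(K\<^bsup>1-p\<^esup>n\<^sup>2)\<close> edges (\<open>removal_bound_of_diamond_free_bounds\<close>). The sum over the
  scales replaces \<open>1/c\<close> by \<open>1/c - 1\<close>: deleting \<open>\<epsilon>n\<^sup>2\<close> edges suffices when
  \<open>K = \<epsilon>\<^bsup>-c/(1-c)-o(1)\<^esup>\<close>, and \<open>\<delta> = 4\<^bsup>-K\<^esup>\<close> is the claimed bound.

  The \<open>o(1)\<close> terms are handled by proving the bound for each fixed exponent above \<open>c/(1-c)\<close> and
  letting the exponent tend to \<open>c/(1-c)\<close> at the end (\<open>exists_vanishing_exponent_error\<close>).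
\<close>

section \<open>Triangles sharing edges\<close>

definition codegree :: "'a set \<Rightarrow> 'a set set \<Rightarrow> 'a set \<Rightarrow> nat" where
  "codegree V E e = card {T \<in> triangles V E. e \<subseteq> T}"

definition overlaps :: "'a set \<Rightarrow> 'a set set \<Rightarrow> ('a set \<times> 'a set) set" where
  "overlaps V E = {(T, T') \<in> triangles V E \<times> triangles V E. card (T \<inter> T') = 2}"

text \<open>
  As \<open>overlaps\<close> is symmetric, these are the triangles that share an edge with no other triangle.
\<close>

definition isolated_triangles :: "'a set \<Rightarrow> 'a set set \<Rightarrow> 'a set set" where
  "isolated_triangles V E = triangles V E - fst ` overlaps V E"

lemma trianglesD:
  assumes "T \<in> triangles V E"
  shows "T \<subseteq> V" "finite T" "card T = 3" "[T]\<^bsup>2\<^esup> \<subseteq> E"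
  using assms by (auto simp: triangles_def nsets_def)

lemma finite_triangles [simp]: "finite V \<Longrightarrow> finite (triangles V E)"
  by (simp add: triangles_def finite_imp_finite_nsets)

lemma finite_overlaps [simp]: "finite V \<Longrightarrow> finite (overlaps V E)"
  by (rule finite_subset[of _ "triangles V E \<times> triangles V E"]) (auto simp: overlaps_def)

lemma simple_graph_finite_edges: "simple_graph V E \<Longrightarrow> finite E"
  unfolding simple_graph_def by (meson finite_imp_finite_nsets finite_subset)

lemma card_pairs_of_triple: "card T = 3 \<Longrightarrow> card ([T]\<^bsup>2\<^esup>) = 3"
  by (simp add: eval_nat_numeral)

text \<open>
  Two different triangles share at most two vertices, so a common edge is their whole intersection.
  This is why \<open>overlaps\<close> can describe sharing an edge by the size of the intersection.
\<close>

lemma distinct_triples_meet_in_pair: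
  assumes "card T = 3" "card T' = 3" "T \<noteq> T'" "e \<subseteq> T" "e \<subseteq> T'" "card e = 2"
  shows "T \<inter> T' = e"
proof -
  have fin: "finite T" "finite T'"
    using assms by (auto intro: card_ge_0_finite)
  have "T \<inter> T' \<noteq> T"
  proof
    assume "T \<inter> T' = T"
    then have "T \<subseteq> T'" by blast
    then show False
      using card_subset_eq[OF fin(2)] assms by simp
  qed
  then have "card (T \<inter> T') < card T"
    by (intro psubset_card_mono fin) blast
  then have "card (T \<inter> T') \<le> card e"
    using assms by simp
  then show ?thesis
    using card_seteq[of "T \<inter> T'" e] assms fin by blast
qed

lemma sum_codegree:
  assumes "simple_graph V E"
  shows "(\<Sum>e\<in>E. codegree V E e) = 3 * card (triangles V E)"
  unfolding codegree_def
proof (rule sum_multicount)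
  show "finite E" "finite (triangles V E)"
    using assms by (auto simp: simple_graph_finite_edges) (simp add: simple_graph_def)
  show "\<forall>T\<in>triangles V E. card {e \<in> E. e \<subseteq> T} = 3"
  proof
    fix T assume T: "T \<in> triangles V E"
    then have "{e \<in> E. e \<subseteq> T} = [T]\<^bsup>2\<^esup>"
      using assms trianglesD[OF T] by (auto simp: simple_graph_def nsets_def)
    then show "card {e \<in> E. e \<subseteq> T} = 3"
      using card_pairs_of_triple[OF trianglesD(3)[OF T]] by (simp only:)
  qed
qed

text \<open>
  Markov's inequality: the codegrees add up to three times the number of triangles.
\<close>

lemma card_edges_of_large_codegree:
  fixes t :: real
  assumes "simple_graph V E"
  shows "t * real (card {e \<in> E. codegree V E e > t}) \<le> 3 * real (card (triangles V E))"
proof -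
  let ?H = "{e \<in> E. real (codegree V E e) > t}"
  have fin: "finite E"
    using assms by (rule simple_graph_finite_edges)
  have "t * real (card ?H) = (\<Sum>e\<in>?H. t)"
    by simp
  also have "\<dots> \<le> (\<Sum>e\<in>?H. real (codegree V E e))"
    by (rule sum_mono) auto
  also have "\<dots> \<le> (\<Sum>e\<in>E. real (codegree V E e))"
    by (rule sum_mono2) (use fin in auto)
  also have "\<dots> = 3 * real (card (triangles V E))"
    unfolding of_nat_sum[symmetric] sum_codegree[OF assms] by simp
  finally show ?thesis .
qed

lemma card_overlaps_le:
  assumes "simple_graph V E" and "\<And>e. e \<in> E \<Longrightarrow> codegree V E e \<le> d"
  shows "card (overlaps V E) \<le> 3 * d * card (triangles V E)"
proof -
  have finV: "finite V" using assms by (simp add: simple_graph_def)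
  have fin: "finite (triangles V E)"
    using finV by simp
  have bound: "card {T' \<in> triangles V E. card (T \<inter> T') = 2} \<le> 3 * d"
    if T: "T \<in> triangles V E" for T
  proof -
    have "{T' \<in> triangles V E. card (T \<inter> T') = 2} \<subseteq> (\<Union>e\<in>[T]\<^bsup>2\<^esup>. {T' \<in> triangles V E. e \<subseteq> T'})"
    proof
      fix T' assume T': "T' \<in> {T' \<in> triangles V E. card (T \<inter> T') = 2}"
      then have "T \<inter> T' \<in> [T]\<^bsup>2\<^esup>"
        using trianglesD(2)[OF T] by (auto simp: nsets_def)
      with T' show "T' \<in> (\<Union>e\<in>[T]\<^bsup>2\<^esup>. {T' \<in> triangles V E. e \<subseteq> T'})"
        by blast
    qed
    then have "card {T' \<in> triangles V E. card (T \<inter> T') = 2}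
        \<le> card (\<Union>e\<in>[T]\<^bsup>2\<^esup>. {T' \<in> triangles V E. e \<subseteq> T'})"
      by (rule card_mono[rotated])
        (use fin finite_imp_finite_nsets[OF trianglesD(2)[OF T]] in auto)
    also have "\<dots> \<le> (\<Sum>e\<in>[T]\<^bsup>2\<^esup>. codegree V E e)"
      unfolding codegree_def
      by (rule card_UN_le) (rule finite_imp_finite_nsets[OF trianglesD(2)[OF T]])
    also have "\<dots> \<le> card ([T]\<^bsup>2\<^esup>) * d"
      using sum_bounded_above[of "[T]\<^bsup>2\<^esup>" "codegree V E" d] assms(2) trianglesD(4)[OF T]
      by auto
    also have "\<dots> = 3 * d"
      using card_pairs_of_triple[OF trianglesD(3)[OF T]] by (simp only:)
    finally show ?thesis .
  qed
  have "overlaps V E = (SIGMA T:triangles V E. {T' \<in> triangles V E. card (T \<inter> T') = 2})"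
    by (auto simp: overlaps_def)
  then have "card (overlaps V E)
      = (\<Sum>T\<in>triangles V E. card {T' \<in> triangles V E. card (T \<inter> T') = 2})"
    using fin by simp
  also have "\<dots> \<le> card (triangles V E) * (3 * d)"
    using sum_bounded_above[of "triangles V E" _ "3 * d"] bound by simp
  finally show ?thesis
    by (simp add: mult_ac)
qed

lemma card_triangles_le_isolated:
  assumes "finite V"
  shows "card (triangles V E) \<le> card (isolated_triangles V E) + card (overlaps V E)"
proof -
  have "card (triangles V E) \<le> card (isolated_triangles V E \<union> fst ` overlaps V E)"
    by (rule card_mono) (use assms in \<open>auto simp: isolated_triangles_def\<close>)
  also have "\<dots> \<le> card (isolated_triangles V E) + card (fst ` overlaps V E)"
    by (rule card_Un_le)
  also have "\<dots> \<le> card (isolated_triangles V E) + card (overlaps V E)"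
    using assms by (simp add: card_image_le)
  finally show ?thesis .
qed

lemma isolated_triangleD:
  assumes "T \<in> isolated_triangles V E" "T' \<in> triangles V E" "e \<subseteq> T" "e \<subseteq> T'" "card e = 2"
  shows "T' = T"
proof (rule ccontr)
  assume "T' \<noteq> T"
  have T: "T \<in> triangles V E"
    using assms(1) by (simp add: isolated_triangles_def)
  have "T \<inter> T' = e"
    by (rule distinct_triples_meet_in_pair)
      (use assms \<open>T' \<noteq> T\<close> trianglesD(3)[OF T] trianglesD(3)[OF assms(2)] in auto)
  then have "(T, T') \<in> overlaps V E"
    using assms T by (auto simp: overlaps_def)
  then show False
    using assms(1) by (force simp: isolated_triangles_def)
qed

text \<open>
  Isolated triangles are edge-disjoint, and their edges span no further triangle: such a triangle
  would share an edge with an isolated one. So their union is a graph in which every edge is in a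
  unique triangle, and it has three edges for each isolated triangle. The set \<open>E\<close> may have edges
  outside \<open>V\<close>, so that \<open>V\<close> can be a sample of the vertices of a larger graph.
\<close>

lemma card_isolated_triangles_le:
  fixes V :: "nat set"
  assumes "finite V" and "diamond_free_bound \<epsilon> (card V)"
  shows "3 * real (card (isolated_triangles V E)) \<le> \<epsilon> * real (card V) ^ 2"
proof -
  let ?I = "isolated_triangles V E"
  let ?U = "\<Union>T\<in>?I. [T]\<^bsup>2\<^esup>"
  have I: "T \<in> triangles V E" if "T \<in> ?I" for T
    using that by (simp add: isolated_triangles_def)
  have finI: "finite ?I"
    using assms(1) by (simp add: isolated_triangles_def)
  have "card ?U = (\<Sum>T\<in>?I. card ([T]\<^bsup>2\<^esup>))"
  proof (rule card_UN_disjoint[OF finI])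
    show "\<forall>T\<in>?I. finite ([T]\<^bsup>2\<^esup>)"
      using I finite_imp_finite_nsets trianglesD(2) by blast
    show "\<forall>T\<in>?I. \<forall>T'\<in>?I. T \<noteq> T' \<longrightarrow> [T]\<^bsup>2\<^esup> \<inter> [T']\<^bsup>2\<^esup> = {}"
    proof (intro ballI impI equals0I)
      fix T T' e
      assume T: "T \<in> ?I" "T' \<in> ?I" "T \<noteq> T'" and e: "e \<in> [T]\<^bsup>2\<^esup> \<inter> [T']\<^bsup>2\<^esup>"
      have "T' = T"
        by (rule isolated_triangleD[OF T(1) I[OF T(2)], of e]) (use e in \<open>auto simp: nsets_def\<close>)
      with T(3) show False by simp
    qed
  qed
  also have "\<dots> = (\<Sum>T\<in>?I. 3)"
    by (rule sum.cong) (rule refl, rule card_pairs_of_triple, rule trianglesD(3), rule I)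
  also have "\<dots> = 3 * card ?I"
    by simp
  finally have card_U: "card ?U = 3 * card ?I" .
  have "?U \<subseteq> [V]\<^bsup>2\<^esup>"
    by (rule UN_least, rule nsets_mono, rule trianglesD(1), rule I)
  then have "simple_graph V ?U"
    using assms(1) by (simp add: simple_graph_def)
  moreover have "edges_in_unique_triangle V ?U"
    unfolding edges_in_unique_triangle_def
  proof
    fix e assume "e \<in> ?U"
    then obtain T where T: "T \<in> ?I" "e \<in> [T]\<^bsup>2\<^esup>"
      by blast
    then have e: "e \<subseteq> T" "card e = 2"
      by (auto simp: nsets_def)
    have "?U \<subseteq> E"
      by (rule UN_least, rule trianglesD(4), rule I)
    then have sub: "triangles V ?U \<subseteq> triangles V E"
      unfolding triangles_def by blast
    show "\<exists>!T. T \<in> triangles V ?U \<and> e \<subseteq> T"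
    proof
      show "T \<in> triangles V ?U \<and> e \<subseteq> T"
        using T(1) e(1) I[OF T(1)] by (auto simp: triangles_def)
      show "T' = T" if "T' \<in> triangles V ?U \<and> e \<subseteq> T'" for T'
        using isolated_triangleD[OF T(1) _ e(1) _ e(2)] that sub by blast
    qed
  qed
  ultimately have "real (card ?U) \<le> \<epsilon> * real (card V) ^ 2"
    using assms(2) unfolding diamond_free_bound_def by blast
  then show ?thesis
    by (simp add: card_U)
qed

section \<open>Counting in random vertex samples\<close>

lemma card_supersets:
  assumes "finite V" "A \<subseteq> V" "card A \<le> m"
  shows "card {S \<in> [V]\<^bsup>m\<^esup>. A \<subseteq> S} = (card V - card A) choose (m - card A)"
proof -
  have fin: "finite A"
    using assms finite_subset by blast
  have "bij_betw (\<lambda>S. S - A) {S \<in> [V]\<^bsup>m\<^esup>. A \<subseteq> S} {B. B \<subseteq> V - A \<and> card B = m - card A}"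
  proof (rule bij_betwI[where g = "\<lambda>B. B \<union> A"])
    show "(\<lambda>S. S - A) \<in> {S \<in> [V]\<^bsup>m\<^esup>. A \<subseteq> S} \<rightarrow> {B. B \<subseteq> V - A \<and> card B = m - card A}"
      using fin by (auto simp: nsets_def card_Diff_subset)
    show "(\<lambda>B. B \<union> A) \<in> {B. B \<subseteq> V - A \<and> card B = m - card A} \<rightarrow> {S \<in> [V]\<^bsup>m\<^esup>. A \<subseteq> S}"
    proof
      fix B assume B: "B \<in> {B. B \<subseteq> V - A \<and> card B = m - card A}"
      then have "finite B" "B \<inter> A = {}"
        using assms(1) by (auto intro: finite_subset)
      then have "card (B \<union> A) = m"
        using B fin assms(3) by (simp add: card_Un_disjoint)
      then show "B \<union> A \<in> {S \<in> [V]\<^bsup>m\<^esup>. A \<subseteq> S}"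
        using B assms \<open>finite B\<close> fin by (auto simp: nsets_def)
    qed
  qed auto
  then have "card {S \<in> [V]\<^bsup>m\<^esup>. A \<subseteq> S} = card {B. B \<subseteq> V - A \<and> card B = m - card A}"
    by (rule bij_betw_same_card)
  also have "\<dots> = card (V - A) choose (m - card A)"
    by (rule n_subsets) (use assms in simp)
  finally show ?thesis
    using assms fin by (simp add: card_Diff_subset)
qed

text \<open>
  A triangle has three vertices and an overlapping pair of triangles has four, so a random
  \<open>m\<close>-subset keeps a triangle with probability about \<open>(m/n)\<^sup>3\<close> and an overlapping pair with
  probability about \<open>(m/n)\<^sup>4\<close>. The next two lemmas are the exact form of this count; there
  \<open>triangles S E\<close> are the triangles of the subgraph induced on \<open>S\<close>.
\<close>

lemma sum_triangles_over_subsets: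
  assumes "finite V" "3 \<le> m"
  shows "(\<Sum>S\<in>[V]\<^bsup>m\<^esup>. card (triangles S E)) = ((card V - 3) choose (m - 3)) * card (triangles V E)"
proof -
  have "(\<Sum>S\<in>[V]\<^bsup>m\<^esup>. card (triangles S E)) = (\<Sum>S\<in>[V]\<^bsup>m\<^esup>. card {T \<in> triangles V E. T \<subseteq> S})"
    by (intro sum.cong refl arg_cong[where f = card])
      (auto simp: triangles_def nsets_def)
  also have "\<dots> = ((card V - 3) choose (m - 3)) * card (triangles V E)"
  proof (rule sum_multicount)
    show "\<forall>T\<in>triangles V E. card {S \<in> [V]\<^bsup>m\<^esup>. T \<subseteq> S} = (card V - 3) choose (m - 3)"
      using card_supersets[OF assms(1), of _ m] assms(2) trianglesD(1,3)[of _ V E] by simp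
  qed (use assms in \<open>auto simp: finite_imp_finite_nsets\<close>)
  finally show ?thesis .
qed

lemma sum_overlaps_over_subsets:
  assumes "finite V" "4 \<le> m"
  shows "(\<Sum>S\<in>[V]\<^bsup>m\<^esup>. card (overlaps S E)) = ((card V - 4) choose (m - 4)) * card (overlaps V E)"
proof -
  have "(\<Sum>S\<in>[V]\<^bsup>m\<^esup>. card (overlaps S E)) = (\<Sum>S\<in>[V]\<^bsup>m\<^esup>. card {p \<in> overlaps V E. fst p \<union> snd p \<subseteq> S})"
    by (intro sum.cong refl arg_cong[where f = card])
      (auto simp: overlaps_def triangles_def nsets_def)
  also have "\<dots> = ((card V - 4) choose (m - 4)) * card (overlaps V E)"
  proof (rule sum_multicount)
    show "\<forall>p\<in>overlaps V E. card {S \<in> [V]\<^bsup>m\<^esup>. fst p \<union> snd p \<subseteq> S} = (card V - 4) choose (m - 4)"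
    proof
      fix p assume "p \<in> overlaps V E"
      then obtain T T' where p: "p = (T, T')" "T \<in> triangles V E" "T' \<in> triangles V E"
          "card (T \<inter> T') = 2"
        by (auto simp: overlaps_def)
      have "card (T \<union> T') = 4"
        using card_Un_Int[of T T'] p trianglesD[OF p(2)] trianglesD[OF p(3)] by simp
      then show "card {S \<in> [V]\<^bsup>m\<^esup>. fst p \<union> snd p \<subseteq> S} = (card V - 4) choose (m - 4)"
        using card_supersets[OF assms(1), of "T \<union> T'" m] assms(2)
          trianglesD(1)[OF p(2)] trianglesD(1)[OF p(3)] p(1) by simp
    qed
  qed (use assms in \<open>auto simp: finite_imp_finite_nsets\<close>)
  finally show ?thesis .
qed

lemma choose_absorb_thrice:
  assumes "3 \<le> m" "m \<le> n"
  shows "real (n choose m) * (real m * (real m - 1) * (real m - 2))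
     = real ((n - 3) choose (m - 3)) * (real n * (real n - 1) * (real n - 2))"
proof -
  have step: "real (k choose j) * real j = real k * real ((k - 1) choose (j - 1))" if "0 < j" for j k :: nat
    using times_binomial_minus1_eq[OF that, of k] by (metis mult.commute of_nat_mult)
  have a: "real (n choose m) * real m = real n * real ((n - 1) choose (m - 1))"
    using step[of m n] assms by simp
  have b: "real ((n - 1) choose (m - 1)) * (real m - 1) = (real n - 1) * real ((n - 2) choose (m - 2))"
    using step[of "m - 1" "n - 1"] assms by (simp add: of_nat_diff numeral_2_eq_2)
  have c: "real ((n - 2) choose (m - 2)) * (real m - 2) = (real n - 2) * real ((n - 3) choose (m - 3))"
    using step[of "m - 2" "n - 2"] assms by (simp add: of_nat_diff numeral_2_eq_2 numeral_3_eq_3)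
  show ?thesis
    using a b c by algebra
qed

lemma choose_absorb_once:
  assumes "4 \<le> m" "m \<le> n"
  shows "real ((n - 3) choose (m - 3)) * (real m - 3) = (real n - 3) * real ((n - 4) choose (m - 4))"
proof -
  have "(m - 3) * ((n - 3) choose (m - 3)) = (n - 3) * ((n - 3 - 1) choose (m - 3 - 1))"
    by (rule times_binomial_minus1_eq) (use assms in simp)
  also have "\<dots> = (n - 3) * ((n - 4) choose (m - 4))"
    by simp
  finally have "real (m - 3) * real ((n - 3) choose (m - 3)) = real (n - 3) * real ((n - 4) choose (m - 4))"
    by (metis of_nat_mult)
  then show ?thesis
    using assms by (simp add: of_nat_diff mult.commute)
qed

text \<open>
  The sampling step. If every edge is in at most \<open>n/(8m)\<close> triangles, then in a random set of \<open>m\<close>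
  vertices a surviving triangle meets on average at most 3/8 other surviving triangles in an edge, so
  a constant proportion of the surviving triangles is isolated. The isolated ones number at most
  \<open>\<epsilon> m\<^sup>2 / 3\<close>, while about \<open>(m/n)\<^sup>3\<close> of all triangles survive. Comparing the two
  counts bounds the number of all triangles.
\<close>

lemma card_triangles_of_small_codegree:
  fixes V :: "nat set"
  assumes graph: "simple_graph V E" and card_V: "card V = n"
    and m: "4 \<le> m" "m \<le> n" and dfb: "diamond_free_bound \<epsilon> m"
    and codeg: "\<And>e. e \<in> E \<Longrightarrow> 8 * m * codegree V E e \<le> n"
  shows "real (card (triangles V E)) \<le> 2 * \<epsilon> * real n ^ 3 / real m"
proof -
  define t where "t = real (card (triangles V E))"
  define C3 where "C3 = real ((n - 3) choose (m - 3))"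
  define C4 where "C4 = real ((n - 4) choose (m - 4))"
  define C where "C = real (n choose m)"
  define q where "q = real (card (overlaps V E))"
  have finV: "finite V"
    using graph by (simp add: simple_graph_def)
  have C3: "C3 > 0"
    using m by (simp add: C3_def)
  have rm: "real m \<ge> 4" and rn: "real n \<ge> real m"
    using m by auto
  have t0: "t \<ge> 0" and q0: "q \<ge> 0" and C40: "C4 \<ge> 0" and C0: "C > 0"
    using m by (auto simp: t_def q_def C4_def C_def)
  have q: "8 * real m * q \<le> 3 * real n * t"
  proof -
    define d where "d = n div (8 * m)"
    have "card (overlaps V E) \<le> 3 * d * card (triangles V E)"
    proof (rule card_overlaps_le[OF graph])
      show "codegree V E e \<le> d" if "e \<in> E" for e
        using codeg[OF that] m by (simp add: d_def less_eq_div_iff_mult_less_eq mult_ac)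
    qed
    then have "8 * m * card (overlaps V E) \<le> 8 * m * (3 * d * card (triangles V E))"
      by simp
    also have "\<dots> = (d * (8 * m)) * (3 * card (triangles V E))"
      by simp
    also have "\<dots> \<le> n * (3 * card (triangles V E))"
      by (rule mult_right_mono) (simp_all add: d_def)
    finally have "real (8 * m * card (overlaps V E)) \<le> real (n * (3 * card (triangles V E)))"
      by (rule of_nat_mono)
    then show ?thesis
      by (simp add: q_def t_def mult_ac)
  qed
  \<comment> \<open>Sum over all samples: triangles minus overlapping pairs is at most isolated triangles.\<close>
  have avg: "3 * (C3 * t) \<le> C * (\<epsilon> * real m ^ 2) + 3 * (C4 * q)"
  proof -
    have pt: "3 * real (card (triangles S E)) \<le> \<epsilon> * real m ^ 2 + 3 * real (card (overlaps S E))"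
      if "S \<in> [V]\<^bsup>m\<^esup>" for S
    proof -
      have S: "finite S" "card S = m"
        using that by (auto simp: nsets_def)
      show ?thesis
        using card_triangles_le_isolated[OF S(1), of E] card_isolated_triangles_le[OF S(1), of \<epsilon> E] dfb S(2)
        by simp
    qed
    have "3 * real (\<Sum>S\<in>[V]\<^bsup>m\<^esup>. card (triangles S E))
        = (\<Sum>S\<in>[V]\<^bsup>m\<^esup>. 3 * real (card (triangles S E)))"
      by (simp add: sum_distrib_left)
    also have "\<dots> \<le> (\<Sum>S\<in>[V]\<^bsup>m\<^esup>. \<epsilon> * real m ^ 2 + 3 * real (card (overlaps S E)))"
      by (rule sum_mono) (rule pt)
    also have "\<dots> = C * (\<epsilon> * real m ^ 2) + 3 * real (\<Sum>S\<in>[V]\<^bsup>m\<^esup>. card (overlaps S E))"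
      by (simp add: sum.distrib sum_distrib_left card_V C_def)
    finally show ?thesis
      using sum_triangles_over_subsets[OF finV, of m E] sum_overlaps_over_subsets[OF finV m(1), of E] m(1) card_V
      by (simp add: t_def q_def C3_def C4_def)
  qed
  \<comment> \<open>An overlapping pair survives less often than a triangle by the factor
    \<open>(m - 3)/(n - 3) \<le> m/n\<close>.\<close>
  have C4: "C4 * real n \<le> C3 * real m"
  proof -
    have e: "C3 * (real m - 3) = (real n - 3) * C4"
      using choose_absorb_once[OF m] by (simp add: C3_def C4_def)
    have "(C4 * real n) * (real n - 3) = real n * (C3 * (real m - 3))"
      using e by (simp add: mult_ac)
    also have "\<dots> \<le> real m * (C3 * (real n - 3))"
      using C3 rn by (simp add: algebra_simps)
    finally have "(C4 * real n) * (real n - 3) \<le> (C3 * real m) * (real n - 3)"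
      by (simp add: mult_ac)
    then show ?thesis
      using rm rn by simp
  qed
  have C4q: "8 * (C4 * q) \<le> 3 * (C3 * t)"
  proof -
    have "(8 * (C4 * q)) * (real m) = C4 * (8 * real m * q)"
      by simp
    also have "\<dots> \<le> C4 * (3 * real n * t)"
      using q C40 by (rule mult_left_mono)
    also have "\<dots> = (C4 * real n) * (3 * t)"
      by simp
    also have "\<dots> \<le> (C3 * real m) * (3 * t)"
      by (rule mult_right_mono[OF C4]) (use t0 in simp)
    finally have "(8 * (C4 * q)) * real m \<le> (3 * (C3 * t)) * real m"
      by (simp add: mult_ac)
    then show ?thesis
      using rm by simp
  qed
  have main: "15 * (C3 * t) \<le> 8 * (C * (\<epsilon> * real m ^ 2))"
    using avg C4q by linarith
  have eps: "0 \<le> \<epsilon>"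
  proof -
    have "0 \<le> C * (\<epsilon> * real m ^ 2)"
      using main C3 t0 by (smt (verit) mult_nonneg_nonneg)
    then show ?thesis
      using C0 rm by (simp add: zero_le_mult_iff)
  qed
  \<comment> \<open>As \<open>m \<ge> 4\<close>, the survival probability of a triangle is at least \<open>3/8 (m/n)\<^sup>3\<close>.\<close>
  have C: "3 * (C * real m ^ 3) \<le> 8 * (C3 * real n ^ 3)"
  proof -
    have "3 * real m ^ 2 \<le> 8 * ((real m - 1) * (real m - 2))"
    proof -
      have "0 \<le> (real m - 4) * (5 * real m - 4)"
        using rm by simp
      then show ?thesis
        by (simp add: algebra_simps power2_eq_square)
    qed
    then have "C * real m * (3 * real m ^ 2) \<le> C * real m * (8 * ((real m - 1) * (real m - 2)))"
      by (rule mult_left_mono) (use C0 in simp)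
    also have "\<dots> = 8 * (C * (real m * (real m - 1) * (real m - 2)))"
      by (simp only: mult_ac)
    also have "\<dots> = 8 * (C3 * (real n * (real n - 1) * (real n - 2)))"
      using choose_absorb_thrice[of m n] m unfolding C_def C3_def by simp
    also have "\<dots> \<le> 8 * (C3 * (real n * real n * real n))"
      using rm rn C3 by (intro mult_left_mono mult_mono) auto
    finally show ?thesis
      by (simp add: power2_eq_square power3_eq_cube mult_ac)
  qed
  have "C3 * (45 * t * real m) = 3 * real m * (15 * (C3 * t))"
    by simp
  also have "\<dots> \<le> 3 * real m * (8 * (C * (\<epsilon> * real m ^ 2)))"
    by (rule mult_left_mono[OF main]) simp
  also have "\<dots> = 8 * \<epsilon> * (3 * (C * real m ^ 3))"
    by (simp add: power2_eq_square power3_eq_cube)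
  also have "\<dots> \<le> 8 * \<epsilon> * (8 * (C3 * real n ^ 3))"
    by (rule mult_left_mono[OF C]) (use eps in simp)
  also have "\<dots> = C3 * (64 * \<epsilon> * real n ^ 3)"
    by simp
  finally have "45 * t * real m \<le> 64 * (\<epsilon> * real n ^ 3)"
    using C3 by simp
  moreover have "0 \<le> \<epsilon> * real n ^ 3"
    using eps by simp
  ultimately have "t * real m \<le> 2 * \<epsilon> * real n ^ 3"
    by linarith
  then show ?thesis
    using rm by (simp add: t_def pos_le_divide_eq)
qed

section \<open>Deleting edges scale by scale\<close>

lemma simple_graph_Diff: "simple_graph V E \<Longrightarrow> simple_graph V (E - H)"
  by (auto simp: simple_graph_def)

lemma codegree_Diff_le: "finite V \<Longrightarrow> codegree V (E - H) e \<le> codegree V E e"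
  unfolding codegree_def by (rule card_mono) (auto simp: triangles_def finite_imp_finite_nsets)

lemma triangle_free_by_deleting_Diff:
  assumes "simple_graph V E" "H \<subseteq> E" "real (card H) \<le> a" "triangle_free_by_deleting b V (E - H)"
  shows "triangle_free_by_deleting (a + b) V E"
proof -
  obtain D where D: "D \<subseteq> E - H" "real (card D) \<le> b" "triangle_free V (E - H - D)"
    using assms(4) by (auto simp: triangle_free_by_deleting_def)
  have "real (card (H \<union> D)) \<le> a + b"
    using card_Un_le[of H D] D(2) assms(3) by linarith
  moreover have "E - (H \<union> D) = E - H - D" by blast
  ultimately show ?thesis
    using D assms(2) unfolding triangle_free_by_deleting_def
    by (intro exI[of _ "H \<union> D"]) auto
qed

lemma triangle_free_by_deleting_mono:
  "triangle_free_by_deleting a V E \<Longrightarrow> a \<le> b \<Longrightarrow> triangle_free_by_deleting b V E"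
  unfolding triangle_free_by_deleting_def by (meson order_trans)

lemma triangle_free_if_codegree_zero:
  assumes "finite V" "\<And>e. e \<in> E \<Longrightarrow> codegree V E e = 0"
  shows "triangle_free V E"
  unfolding triangle_free_def
proof (rule equals0I)
  fix T assume T: "T \<in> triangles V E"
  have "card ([T]\<^bsup>2\<^esup>) = 3"
    by (rule card_pairs_of_triple[OF trianglesD(3)[OF T]])
  then obtain e where e: "e \<in> [T]\<^bsup>2\<^esup>"
    by (metis card.empty equals0I zero_neq_numeral)
  have "codegree V E e = 0"
    using assms(2) trianglesD(4)[OF T] e by blast
  then have "{T \<in> triangles V E. e \<subseteq> T} = {}"
    using assms(1) by (simp add: codegree_def)
  with T e show False
    by (auto simp: nsets_def)
qed

text \<open>
  If no edge is in more than \<open>n/2\<^bsup>k+3\<^esup>\<close> triangles, sampling \<open>2\<^sup>k\<close> vertices bounds the number of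
  triangles by \<open>2\<epsilon>n\<^sup>3/2\<^sup>k\<close>. Each edge in the top half of the codegree range is in more than
  \<open>n/2\<^bsup>k+4\<^esup>\<close> of them, so there are few such edges, and all of them can be deleted. The powers of two
  cancel: the cost depends on the scale only through \<open>\<epsilon>\<close>.
\<close>

lemma card_top_scale_le:
  fixes V :: "nat set"
  assumes "simple_graph V E" "card V = n" "2 \<le> k" "2 ^ k \<le> n" "diamond_free_bound \<epsilon> (2 ^ k)"
    and "\<And>e. e \<in> E \<Longrightarrow> 2 ^ (k + 3) * codegree V E e \<le> n"
  shows "real (card {e \<in> E. codegree V E e > real n / 2 ^ (k + 4)}) \<le> 96 * \<epsilon> * real n ^ 2"
proof -
  let ?h = "real (card {e \<in> E. codegree V E e > real n / 2 ^ (k + 4)})"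
  have "(2::nat) ^ 2 \<le> 2 ^ k"
    using assms(3) by (intro power_increasing) auto
  then have "real (card (triangles V E)) \<le> 2 * \<epsilon> * real n ^ 3 / real (2 ^ k)"
    using assms by (intro card_triangles_of_small_codegree) (auto simp: power_add mult_ac)
  moreover have "real n / 2 ^ (k + 4) * ?h \<le> 3 * real (card (triangles V E))"
    by (rule card_edges_of_large_codegree) fact
  ultimately have "real n / 2 ^ (k + 4) * ?h \<le> 6 * \<epsilon> * real n ^ 3 / 2 ^ k"
    by simp
  then have "real n * ?h \<le> real n * (96 * \<epsilon> * real n ^ 2)"
    by (simp add: power_add field_simps power2_eq_square power3_eq_cube)
  moreover have "real n > 0"
    using assms(4) by (metis less_le_trans of_nat_0_less_iff zero_less_numeral zero_less_power)
  ultimately show ?thesis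
    by simp
qed

text \<open>
  Halving the maximum codegree again and again, until it is below 1 and no triangle is left. The scale
  \<open>2\<^sup>i\<close> costs \<open>96 a\<^sub>i n\<^sup>2\<close> edges. The number \<open>d\<close> of scales that still matter is about
  \<open>log\<^sub>2 n - k\<close>, so a bound independent of \<open>n\<close> needs \<open>a\<close> to be summable.
\<close>

lemma triangle_free_by_deleting_scales:
  fixes V :: "nat set" and a :: "nat \<Rightarrow> real"
  assumes card_V: "card V = n" and K: "2 \<le> K"
    and dfb: "\<And>k. K \<le> k \<Longrightarrow> diamond_free_bound (a k) (2 ^ k)"
    and nonneg: "\<And>k. 0 \<le> a k"
  shows "simple_graph V E \<Longrightarrow> K \<le> k \<Longrightarrow> n < 2 ^ (k + d + 3) \<Longrightarrow>
    (\<And>e. e \<in> E \<Longrightarrow> 2 ^ (k + 3) * codegree V E e \<le> n) \<Longrightarrow>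
    triangle_free_by_deleting (96 * (\<Sum>i = k..<k + d. a i) * real n ^ 2) V E"
proof (induction d arbitrary: k E)
  \<comment> \<open>At the last scale every codegree is a natural number below 1.\<close>
  have small: "triangle_free_by_deleting b V E"
    if "simple_graph V E" "n < 2 ^ (k + 3)" "\<And>e. e \<in> E \<Longrightarrow> 2 ^ (k + 3) * codegree V E e \<le> n" "0 \<le> b"
    for k E and b :: real
  proof -
    have "codegree V E e = 0" if "e \<in> E" for e
    proof (rule ccontr)
      assume "codegree V E e \<noteq> 0"
      then have "2 ^ (k + 3) * 1 \<le> 2 ^ (k + 3) * codegree V E e"
        by (intro mult_left_mono) auto
      with \<open>\<And>e. e \<in> E \<Longrightarrow> 2 ^ (k + 3) * codegree V E e \<le> n\<close>[OF that] \<open>n < 2 ^ (k + 3)\<close>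
      show False by linarith
    qed
    then have "triangle_free V E"
      using that(1) by (intro triangle_free_if_codegree_zero) (auto simp: simple_graph_def)
    then show ?thesis
      using \<open>0 \<le> b\<close> unfolding triangle_free_by_deleting_def by (intro exI[of _ "{}"]) auto
  qed
  {
    case 0
    then show ?case by (intro small[of E k]) auto
  next
    case (Suc d)
    show ?case
    proof (cases "n < 2 ^ (k + 3)")
      case True
      then show ?thesis
        using Suc.prems by (intro small[of E k] mult_nonneg_nonneg sum_nonneg nonneg) simp_all
    next
      case False
      have "(2::nat) ^ k \<le> 2 ^ (k + 3)"
        by (intro power_increasing) auto
      with False have n: "2 ^ k \<le> n"
        by linarith
      let ?H = "{e \<in> E. codegree V E e > real n / 2 ^ (k + 4)}"
      have "real (card ?H) \<le> 96 * a k * real n ^ 2"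
        using Suc.prems K n by (intro card_top_scale_le card_V dfb) auto
      moreover have "triangle_free_by_deleting (96 * (\<Sum>i = Suc k..<Suc k + d. a i) * real n ^ 2) V (E - ?H)"
      proof (rule Suc.IH)
        show "2 ^ (Suc k + 3) * codegree V (E - ?H) e \<le> n" if "e \<in> E - ?H" for e
        proof -
          have "codegree V (E - ?H) e \<le> codegree V E e"
            using Suc.prems(1) by (intro codegree_Diff_le) (simp add: simple_graph_def)
          also have "real (codegree V E e) \<le> real n / 2 ^ (k + 4)"
            using that by auto
          finally have "real (codegree V (E - ?H) e) * 2 ^ (k + 4) \<le> real n"
            by (simp add: pos_le_divide_eq)
          then have "real (2 ^ (Suc k + 3) * codegree V (E - ?H) e) \<le> real n"
            by (simp add: power_add mult_ac)
          then show ?thesis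
            by (simp only: of_nat_le_iff)
        qed
      qed (use Suc.prems in \<open>auto simp: simple_graph_Diff\<close>)
      ultimately have "triangle_free_by_deleting
          (96 * a k * real n ^ 2 + 96 * (\<Sum>i = Suc k..<Suc k + d. a i) * real n ^ 2) V E"
        by (intro triangle_free_by_deleting_Diff[where H = ?H] Suc.prems) auto
      moreover have "(\<Sum>i = k..<k + Suc d. a i) = a k + (\<Sum>i = Suc k..<Suc k + d. a i)"
        by (subst sum.atLeast_Suc_lessThan) simp_all
      ultimately show ?thesis
        by (simp only: distrib_left distrib_right)
    qed
  }
qed

lemma removal_bound_mono:
  assumes rb: "removal_bound \<epsilon> \<delta>" and le: "\<epsilon> \<le> \<epsilon>'" "\<delta>' \<le> \<delta>"
  shows "removal_bound \<epsilon>' \<delta>'"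
  unfolding removal_bound_def
proof (intro allI impI)
  fix n and V :: "nat set" and E
  assume *: "simple_graph V E" "card V = n" "real (card (triangles V E)) < \<delta>' * real n ^ 3"
  have "\<delta>' * real n ^ 3 \<le> \<delta> * real n ^ 3" "\<epsilon> * real n ^ 2 \<le> \<epsilon>' * real n ^ 2"
    using le by (simp_all add: mult_right_mono)
  moreover from this(1) have "real (card (triangles V E)) < \<delta> * real n ^ 3"
    using *(3) by linarith
  then have "triangle_free_by_deleting (\<epsilon> * real n ^ 2) V E"
    by (rule rb[unfolded removal_bound_def, rule_format, OF *(1,2)])
  ultimately show "triangle_free_by_deleting (\<epsilon>' * real n ^ 2) V E"
    by (blast intro: triangle_free_by_deleting_mono)
qed

text \<open>
  With fewer than \<open>n\<^sup>3/4\<^sup>K\<close> triangles, Markov's inequality leaves only \<open>24n\<^sup>2/2\<^sup>K\<close> edges of codegree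
  above \<open>n/2\<^bsup>K+3\<^esup>\<close>. Once they are deleted, the halving can start at the scale \<open>2\<^sup>K\<close>, so that just the
  tail of \<open>a\<close> from \<open>K\<close> on is paid. This is how few triangles lead to few deletions.
\<close>

lemma removal_bound_of_diamond_free_bounds:
  fixes a :: "nat \<Rightarrow> real"
  assumes K: "2 \<le> K"
    and dfb: "\<And>k. K \<le> k \<Longrightarrow> diamond_free_bound (a k) (2 ^ k)"
    and nonneg: "\<And>k. 0 \<le> a k"
    and sum: "\<And>N. (\<Sum>i = K..<N. a i) \<le> s"
  shows "removal_bound (96 * s + 24 / 2 ^ K) (1 / 4 ^ K)"
  unfolding removal_bound_def
proof (intro allI impI)
  fix n and V :: "nat set" and E
  assume graph: "simple_graph V E" and card_V: "card V = n"
    and few: "real (card (triangles V E)) < 1 / 4 ^ K * real n ^ 3"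
  have n: "real n > 0"
    using few by (cases "n = 0") auto
  let ?H = "{e \<in> E. codegree V E e > real n / 2 ^ (K + 3)}"
  have "real n / 2 ^ (K + 3) * real (card ?H) \<le> 3 * real (card (triangles V E))"
    by (rule card_edges_of_large_codegree) fact
  also have "\<dots> \<le> 3 * (1 / 4 ^ K * real n ^ 3)"
    using few by simp
  also have "(4::real) ^ K = 2 ^ K * 2 ^ K"
    by (simp flip: power_mult_distrib)
  finally have "real n * real (card ?H) \<le> real n * (24 / 2 ^ K * real n ^ 2)"
    by (simp add: power_add field_simps power2_eq_square power3_eq_cube)
  then have "real (card ?H) \<le> 24 / 2 ^ K * real n ^ 2"
    using n by (rule mult_left_le_imp_le)
  moreover have "triangle_free_by_deleting (96 * (\<Sum>i = K..<K + n. a i) * real n ^ 2) V (E - ?H)"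
  proof (rule triangle_free_by_deleting_scales[OF card_V K dfb nonneg])
    have "n < 2 ^ n"
      by (rule less_exp)
    also have "\<dots> \<le> (2::nat) ^ (K + n + 3)"
      by (intro power_increasing) auto
    finally show "n < 2 ^ (K + n + 3)" .
    show "2 ^ (K + 3) * codegree V (E - ?H) e \<le> n" if "e \<in> E - ?H" for e
    proof -
      have "codegree V (E - ?H) e \<le> codegree V E e"
        using graph by (intro codegree_Diff_le) (simp add: simple_graph_def)
      also have "real (codegree V E e) \<le> real n / 2 ^ (K + 3)"
        using that by auto
      finally have "real (codegree V (E - ?H) e) * 2 ^ (K + 3) \<le> real n"
        by (simp add: pos_le_divide_eq)
      then have "real (2 ^ (K + 3) * codegree V (E - ?H) e) \<le> real n"
        by (simp add: mult_ac)
      then show ?thesis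
        by (simp only: of_nat_le_iff)
    qed
  qed (use graph in \<open>auto simp: simple_graph_Diff\<close>)
  ultimately have "triangle_free_by_deleting
      (24 / 2 ^ K * real n ^ 2 + 96 * (\<Sum>i = K..<K + n. a i) * real n ^ 2) V E"
    by (intro triangle_free_by_deleting_Diff[where H = ?H] graph) auto
  then show "triangle_free_by_deleting ((96 * s + 24 / 2 ^ K) * real n ^ 2) V E"
  proof (rule triangle_free_by_deleting_mono)
    have "24 / 2 ^ K * real n ^ 2 + 96 * (\<Sum>i = K..<K + n. a i) * real n ^ 2
        = (24 / 2 ^ K + 96 * (\<Sum>i = K..<K + n. a i)) * real n ^ 2"
      by (simp add: algebra_simps)
    also have "\<dots> \<le> (24 / 2 ^ K + 96 * s) * real n ^ 2"
      using sum by (intro mult_right_mono add_left_mono mult_left_mono) auto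
    finally show "24 / 2 ^ K * real n ^ 2 + 96 * (\<Sum>i = K..<K + n. a i) * real n ^ 2
        \<le> (96 * s + 24 / 2 ^ K) * real n ^ 2"
      by (simp add: add.commute)
  qed
qed

section \<open>The largest removal bound\<close>

text \<open>
  A single triangle on three vertices is the obstruction: less than one edge may be deleted.
\<close>

lemma removal_bound_le:
  assumes "removal_bound \<epsilon> \<delta>" "\<epsilon> < 1 / 9"
  shows "\<delta> \<le> 1 / 27"
proof (rule ccontr)
  assume "\<not> \<delta> \<le> 1 / 27"
  define V where "V = {0, 1, 2 :: nat}"
  have V: "finite V" "card V = 3"
    by (auto simp: V_def)
  have tri: "triangles V ([V]\<^bsup>2\<^esup>) = {V}"
    using V card_subset_eq[OF V(1)] by (auto simp: triangles_def nsets_def)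
  have "real (card (triangles V ([V]\<^bsup>2\<^esup>))) < \<delta> * real 3 ^ 3"
    using tri \<open>\<not> \<delta> \<le> 1 / 27\<close> by simp
  moreover have "simple_graph V ([V]\<^bsup>2\<^esup>)"
    using V by (simp add: simple_graph_def)
  ultimately have "triangle_free_by_deleting (\<epsilon> * real 3 ^ 2) V ([V]\<^bsup>2\<^esup>)"
    using assms(1) V(2) unfolding removal_bound_def by blast
  then obtain D where D: "D \<subseteq> [V]\<^bsup>2\<^esup>" "real (card D) \<le> \<epsilon> * 9" "triangle_free V ([V]\<^bsup>2\<^esup> - D)"
    by (auto simp: triangle_free_by_deleting_def)
  have "real (card D) < 1"
    using D(2) assms(2) by linarith
  then have "card D = 0"
    by simp
  moreover have "finite D"
    using D(1) V(1) finite_imp_finite_nsets finite_subset by blast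
  ultimately show False
    using D(3) tri by (simp add: triangle_free_def)
qed

text \<open>
  Removal bounds are bounded above, and since the number of triangles is required to be strictly
  smaller than \<open>\<delta> n\<^sup>3\<close>, their supremum is again a removal bound. So the greatest one exists, and each
  removal bound is a lower bound for it.
\<close>

lemma delta_TRL_ge:
  assumes \<epsilon>: "\<epsilon> < 1 / 9" and \<delta>: "0 < \<delta>" "removal_bound \<epsilon> \<delta>"
  shows "\<delta> \<le> delta_TRL \<epsilon>"
proof -
  define A where "A = {\<delta>. 0 < \<delta> \<and> removal_bound \<epsilon> \<delta>}"
  have bdd: "bdd_above A"
    using removal_bound_le \<epsilon> by (intro bdd_aboveI[of _ "1 / 27"]) (auto simp: A_def)
  have \<delta>A: "\<delta> \<in> A"
    using \<delta> by (simp add: A_def)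
  have upper: "y \<le> Sup A" if "y \<in> A" for y
    using that bdd by (rule cSup_upper)
  have "removal_bound \<epsilon> (Sup A)"
    unfolding removal_bound_def
  proof (intro allI impI)
    fix n and V :: "nat set" and E
    assume *: "simple_graph V E" "card V = n" "real (card (triangles V E)) < Sup A * real n ^ 3"
    then have n: "real n ^ 3 > 0"
      by (cases "n = 0") auto
    then have "real (card (triangles V E)) / real n ^ 3 < Sup A"
      using *(3) by (simp add: pos_divide_less_eq)
    then obtain y where y: "y \<in> A" "real (card (triangles V E)) / real n ^ 3 < y"
      using less_cSup_iff[of A] \<delta>A bdd by blast
    then show "triangle_free_by_deleting (\<epsilon> * real n ^ 2) V E"
      using * n by (auto simp: A_def removal_bound_def pos_divide_less_eq)
  qed
  moreover have "0 < Sup A"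
    using upper[OF \<delta>A] \<delta>(1) by linarith
  ultimately have "delta_TRL \<epsilon> = Sup A"
    unfolding delta_TRL_def by (intro Greatest_equality upper) (auto simp: A_def)
  then show ?thesis
    using upper[OF \<delta>A] by simp
qed

section \<open>Asymptotics\<close>

text \<open>
  The integral bound for the tail of \<open>\<Sum>k\<^bsup>-p\<^esup>\<close>: by the mean value theorem each term is dominated by a
  difference of consecutive values of \<open>x\<^bsup>1-p\<^esup>/(p-1)\<close>, and these telescope.
\<close>

lemma powr_tail_sum_le:
  fixes p :: real
  assumes p: "1 < p" and K: "2 \<le> K"
  shows "(\<Sum>k = K..<N. real k powr - p) \<le> (real K - 1) powr (1 - p) / (p - 1)"
proof -
  have decrement: "(p - 1) * real k powr - p \<le> (real k - 1) powr (1 - p) - real k powr (1 - p)"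
    if k: "2 \<le> k" for k :: nat
  proof -
    have "\<exists>z. real k - 1 < z \<and> z < real k \<and>
        real k powr (1 - p) - (real k - 1) powr (1 - p) = (real k - (real k - 1)) * ((1 - p) * z powr (1 - p - 1))"
    proof (rule MVT2)
      show "((\<lambda>x. x powr (1 - p)) has_real_derivative (1 - p) * x powr (1 - p - 1)) (at x)"
        if "real k - 1 \<le> x" "x \<le> real k" for x
        using that k by (intro has_real_derivative_powr) auto
    qed simp
    then obtain z where z: "real k - 1 < z" "z < real k"
        "real k powr (1 - p) - (real k - 1) powr (1 - p) = (1 - p) * z powr - p"
      by auto
    have "real k powr - p \<le> z powr - p"
      using z k p by (intro powr_mono2') auto
    then have "(p - 1) * real k powr - p \<le> (p - 1) * z powr - p"
      using p by (intro mult_left_mono) auto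
    then show ?thesis
      using z(3) by (simp add: algebra_simps)
  qed
  have "(p - 1) * (\<Sum>k = K..<N. real k powr - p) \<le> (real K - 1) powr (1 - p)"
  proof (cases "K \<le> N")
    case True
    then have "(p - 1) * (\<Sum>k = K..<N. real k powr - p)
        \<le> (real K - 1) powr (1 - p) - (real N - 1) powr (1 - p)"
    proof (induction N rule: dec_induct)
      case (step N)
      then show ?case
        using decrement[of N] K by (simp add: algebra_simps)
    qed simp
    then show ?thesis
      using powr_ge_zero[of "real N - 1" "1 - p"] by linarith
  qed simp
  then show ?thesis
    using p by (simp add: pos_le_divide_eq mult.commute)
qed

text \<open>
  Summing the deletions over all scales from \<open>K\<close> on lowers the exponent by one, from \<open>p\<close> to \<open>p - 1\<close>;
  the constant factors are absorbed by the gap between \<open>r\<close> and \<open>p - 1\<close>.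
\<close>

lemma eventually_removal_bound_powr:
  fixes p r :: real
  assumes r: "0 < r" "r < p - 1"
    and dfb: "\<forall>\<^sub>F k in sequentially. diamond_free_bound (real k powr - p) (2 ^ k)"
  shows "\<forall>\<^sub>F K in sequentially. removal_bound (real K powr - r) (1 / 4 ^ K)"
proof -
  have "\<forall>\<^sub>F K in sequentially. 96 * ((real K - 1) powr (1 - p) / (p - 1)) + 24 / 2 ^ K \<le> real K powr - r"
    using r by real_asymp
  moreover have "\<forall>\<^sub>F K in sequentially. \<forall>k\<ge>K. diamond_free_bound (real k powr - p) (2 ^ k)"
    using dfb by (rule eventually_all_ge_at_top)
  ultimately show ?thesis
    using eventually_ge_at_top[of 2]
  proof eventually_elim
    case (elim K)
    have "removal_bound (96 * ((real K - 1) powr (1 - p) / (p - 1)) + 24 / 2 ^ K) (1 / 4 ^ K)"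
      using elim r by (intro removal_bound_of_diamond_free_bounds[where a = "\<lambda>k. real k powr - p"]
          powr_tail_sum_le) auto
    then show ?case
      using elim(1) by (rule removal_bound_mono) simp
  qed
qed

text \<open>
  The hypothesis of the theorem read from the side of \<open>n = 2\<^sup>k\<close>: as \<open>N\<^sub>D\<^sub>F\<^sub>L(\<epsilon>) \<le> 2\<^sup>k\<close> for
  \<open>\<epsilon> = k\<^bsup>-p\<^esup>\<close>, a graph on \<open>2\<^sup>k\<close> vertices with each edge in a unique triangle has edge density at most
  \<open>k\<^bsup>-p\<^esup>\<close>. The \<open>o(1)\<close> term is absorbed by the gap between \<open>c\<close> and \<open>1/p\<close>.
\<close>

lemma eventually_diamond_free_bound_powr:
  fixes c p :: real and h :: "real \<Rightarrow> real"
  assumes p: "0 < p" "c < 1 / p" and h: "(h \<longlongrightarrow> 0) (at_right 0)"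
    and N: "\<forall>\<^sub>F \<epsilon> in at_right 0. ereal_of_enat (N_DFL \<epsilon>) \<le> ereal (2 powr (\<epsilon> powr (- c + h \<epsilon>)))"
  shows "\<forall>\<^sub>F k in sequentially. diamond_free_bound (real k powr - p) (2 ^ k)"
proof -
  have "\<forall>\<^sub>F \<epsilon> in at_right 0. h \<epsilon> > c - 1 / p"
    using h p by (intro order_tendstoD(1)) auto
  moreover have "\<forall>\<^sub>F \<epsilon> :: real in at_right 0. \<epsilon> \<in> {0<..<1}"
    by (rule eventually_at_right_real) simp
  ultimately have *: "\<forall>\<^sub>F \<epsilon> in at_right 0. ereal_of_enat (N_DFL \<epsilon>) \<le> ereal (2 powr (\<epsilon> powr (- (1 / p))))"
    using N
  proof eventually_elim
    case (elim \<epsilon>)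
    have "\<epsilon> powr (- c + h \<epsilon>) \<le> \<epsilon> powr (- (1 / p))"
      using elim by (intro powr_mono') auto
    then have "2 powr (\<epsilon> powr (- c + h \<epsilon>)) \<le> 2 powr (\<epsilon> powr (- (1 / p)))"
      by (rule powr_mono) simp
    with elim(3) show ?case
      by (meson ereal_less_eq(3) order_trans)
  qed
  have "filterlim (\<lambda>k. real k powr - p) (at_right 0) sequentially"
    using p(1) by real_asymp
  from eventually_compose_filterlim[OF * this] eventually_gt_at_top[of 0] show ?thesis
  proof eventually_elim
    case (elim k)
    have "(real k powr - p) powr (- (1 / p)) = real k"
      using p(1) elim(2) by (simp add: powr_powr)
    then have "ereal_of_enat (N_DFL (real k powr - p)) \<le> ereal_of_enat (enat (2 ^ k))"
      using elim by (simp add: powr_realpow)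
    then show ?case
      by (simp only: ereal_of_enat_le_iff N_DFL_le_iff)
  qed
qed

text \<open>
  Inverting \<open>\<epsilon> = K\<^bsup>-r\<^esup>\<close> gives \<open>K = \<epsilon>\<^bsup>-1/r\<^esup>\<close>, hence \<open>\<delta> = 4\<^bsup>-K\<^esup>\<close>. Rounding \<open>K\<close> up and writing \<open>4\<^sup>K\<close> as
  \<open>2\<^bsup>2K\<^esup>\<close> cost a little in the exponent, which the gap between \<open>1/r\<close> and \<open>q\<close> absorbs.
\<close>

lemma eventually_delta_TRL_ge:
  fixes r q :: real
  assumes r: "0 < r" and q: "1 / r < q"
    and rb: "\<forall>\<^sub>F K in sequentially. removal_bound (real K powr - r) (1 / 4 ^ K)"
  shows "\<forall>\<^sub>F \<epsilon> in at_right 0. delta_TRL \<epsilon> \<ge> 2 powr (- (\<epsilon> powr - q))"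
proof -
  define K where "K = (\<lambda>\<epsilon> :: real. nat \<lceil>\<epsilon> powr (- (1 / r))\<rceil>)"
  have r': "0 < 1 / r"
    using r by simp
  have "filterlim K at_top (at_right 0)"
    unfolding K_def using r by real_asymp
  note rb' = eventually_compose_filterlim[OF rb this]
  have "\<forall>\<^sub>F \<epsilon> in at_right 0. 2 * (\<epsilon> powr (- (1 / r)) + 1) \<le> \<epsilon> powr - q"
    using r' q by real_asymp
  moreover have "\<forall>\<^sub>F \<epsilon> :: real in at_right 0. \<epsilon> \<in> {0<..<1 / 9}"
    by (rule eventually_at_right_real) simp
  ultimately show ?thesis
    using rb'
  proof eventually_elim
    case (elim \<epsilon>)
    have pos: "0 < \<epsilon> powr (- (1 / r))"
      using elim(2) by simp
    then have K: "\<epsilon> powr (- (1 / r)) \<le> real (K \<epsilon>)" "real (K \<epsilon>) \<le> \<epsilon> powr (- (1 / r)) + 1"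
      unfolding K_def by linarith+
    have "real (K \<epsilon>) powr - r \<le> (\<epsilon> powr (- (1 / r))) powr - r"
      using r pos K(1) by (intro powr_mono2') auto
    also have "\<dots> = \<epsilon>"
      using r elim(2) by (simp add: powr_powr)
    finally have small: "real (K \<epsilon>) powr - r \<le> \<epsilon>" .
    have "2 powr (- (\<epsilon> powr - q)) \<le> 2 powr (- (2 * real (K \<epsilon>)))"
      using K(2) elim(1) by (intro powr_mono) auto
    also have "\<dots> = 1 / 4 ^ K \<epsilon>"
      by (simp add: powr_minus_divide powr_realpow flip: powr_powr)
    finally have "removal_bound \<epsilon> (2 powr (- (\<epsilon> powr - q)))"
      by (rule removal_bound_mono[OF elim(3) small])
    then show ?case
      using elim(2) by (intro delta_TRL_ge) auto
  qed
qed

text \<open>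
  A bound that holds eventually for each fixed exponent above \<open>q\<^sub>0\<close> holds for a single
  exponent \<open>q\<^sub>0 + o(1)\<close>: take the infimum of the exponents that work for the given \<open>\<epsilon>\<close>. As the infimum
  itself need not work, \<open>\<epsilon>\<close> is added to it.
\<close>

lemma exists_vanishing_exponent_error:
  fixes P :: "real \<Rightarrow> real \<Rightarrow> bool" and q0 :: real
  assumes ev: "\<And>q. q0 < q \<Longrightarrow> \<forall>\<^sub>F \<epsilon> in at_right 0. P q \<epsilon>"
    and up: "\<And>q q' \<epsilon>. \<lbrakk>0 < \<epsilon>; \<epsilon> < 1; P q \<epsilon>; q \<le> q'\<rbrakk> \<Longrightarrow> P q' \<epsilon>"
  shows "\<exists>g. (g \<longlongrightarrow> 0) (at_right 0) \<and> (\<forall>\<^sub>F \<epsilon> in at_right 0. P (q0 - g \<epsilon>) \<epsilon>)"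
proof -
  define A where "A = (\<lambda>\<epsilon>. {q. q0 < q \<and> P q \<epsilon>})"
  have bdd: "bdd_below (A \<epsilon>)" for \<epsilon>
    by (rule bdd_belowI[of _ q0]) (auto simp: A_def)
  define g where "g = (\<lambda>\<epsilon>. q0 - (Inf (A \<epsilon>) + \<epsilon>))"
  have unit: "\<forall>\<^sub>F \<epsilon> :: real in at_right 0. \<epsilon> \<in> {0<..<1}"
    by (rule eventually_at_right_real) simp
  have "(g \<longlongrightarrow> 0) (at_right 0)"
  proof (rule tendstoI)
    fix e :: real assume e: "0 < e"
    have "\<forall>\<^sub>F \<epsilon> :: real in at_right 0. \<epsilon> \<in> {0<..<e / 2}"
      using e by (intro eventually_at_right_real) simp
    moreover have "\<forall>\<^sub>F \<epsilon> in at_right 0. P (q0 + e / 2) \<epsilon>"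
      using e by (intro ev) simp
    ultimately show "\<forall>\<^sub>F \<epsilon> in at_right 0. dist (g \<epsilon>) 0 < e"
    proof eventually_elim
      case (elim \<epsilon>)
      have mem: "q0 + e / 2 \<in> A \<epsilon>"
        using elim(2) e by (simp add: A_def)
      have "Inf (A \<epsilon>) \<le> q0 + e / 2"
        using mem bdd by (rule cInf_lower)
      moreover have "q0 \<le> Inf (A \<epsilon>)"
      proof (rule cInf_greatest)
        show "A \<epsilon> \<noteq> {}"
          using mem by blast
      qed (simp add: A_def)
      ultimately show ?case
        using elim(1) by (auto simp: g_def dist_real_def)
    qed
  qed
  moreover have "\<forall>\<^sub>F \<epsilon> in at_right 0. P (q0 - g \<epsilon>) \<epsilon>"
    using unit ev[of "q0 + 1", simplified]
  proof eventually_elim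
    case (elim \<epsilon>)
    have "A \<epsilon> \<noteq> {}"
      using elim(2) by (auto simp: A_def intro: exI[of _ "q0 + 1"])
    then obtain q where "q \<in> A \<epsilon>" "q < Inf (A \<epsilon>) + \<epsilon>"
      using cInf_lessD[of "A \<epsilon>" "Inf (A \<epsilon>) + \<epsilon>"] elim(1) by fastforce
    then have "P q \<epsilon>" "q \<le> Inf (A \<epsilon>) + \<epsilon>"
      by (simp_all add: A_def)
    then have "P (Inf (A \<epsilon>) + \<epsilon>) \<epsilon>"
      using elim(1) up[of \<epsilon> q] by simp
    then show ?case
      by (simp add: g_def)
  qed
  ultimately show ?thesis
    by blast
qed

theorem theorem1p12:
  fixes c :: real
  assumes "0 < c" and "c < 1"
    and "\<exists>h :: real \<Rightarrow> real. (h \<longlongrightarrow> 0) (at_right 0) \<and>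
           (\<forall>\<^sub>F \<epsilon> in at_right 0.
              ereal_of_enat (N_DFL \<epsilon>) \<le> ereal (2 powr (\<epsilon> powr (- c + h \<epsilon>))))"
  shows "\<exists>g :: real \<Rightarrow> real. (g \<longlongrightarrow> 0) (at_right 0) \<and>
           (\<forall>\<^sub>F \<epsilon> in at_right 0.
              delta_TRL \<epsilon> \<ge> 2 powr (- (\<epsilon> powr (- (c / (1 - c)) + g \<epsilon>))))"
proof -
  obtain h where h: "(h \<longlongrightarrow> 0) (at_right 0)"
    "\<forall>\<^sub>F \<epsilon> in at_right 0. ereal_of_enat (N_DFL \<epsilon>) \<le> ereal (2 powr (\<epsilon> powr (- c + h \<epsilon>)))"
    using assms(3) by blast
  have "\<exists>g :: real \<Rightarrow> real. (g \<longlongrightarrow> 0) (at_right 0) \<and>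
      (\<forall>\<^sub>F \<epsilon> in at_right 0. delta_TRL \<epsilon> \<ge> 2 powr (- (\<epsilon> powr - (c / (1 - c) - g \<epsilon>))))"
  proof (rule exists_vanishing_exponent_error)
    fix q assume q: "c / (1 - c) < q"
    have "0 < c / (1 - c)"
      using assms by simp
    with q have "0 < q" by linarith
    \<comment> \<open>The exponents are chosen as \<open>1/q < r < p - 1 < 1/c - 1\<close>; each inequality leaves room for
      one of the three asymptotic steps.\<close>
    with q assms have "1 / q < 1 / c - 1"
      by (simp add: field_simps)
    then obtain r where r: "1 / q < r" "r < 1 / c - 1"
      using dense by blast
    then have "r + 1 < 1 / c" by simp
    then obtain p where p: "r + 1 < p" "p < 1 / c"
      using dense by blast
    have "0 < 1 / q"
      using \<open>0 < q\<close> by simp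
    then have "0 < r" "0 < p"
      using r p by linarith+
    then have cp: "c < 1 / p" and rq: "1 / r < q"
      using p(2) r(1) assms(1) \<open>0 < q\<close> by (simp_all add: field_simps)
    have "\<forall>\<^sub>F k in sequentially. diamond_free_bound (real k powr - p) (2 ^ k)"
      by (rule eventually_diamond_free_bound_powr[OF \<open>0 < p\<close> cp h])
    then have "\<forall>\<^sub>F K in sequentially. removal_bound (real K powr - r) (1 / 4 ^ K)"
      using \<open>0 < r\<close> p(1) by (intro eventually_removal_bound_powr) auto
    then show "\<forall>\<^sub>F \<epsilon> in at_right 0. delta_TRL \<epsilon> \<ge> 2 powr (- (\<epsilon> powr - q))"
      using \<open>0 < r\<close> rq by (intro eventually_delta_TRL_ge)
  next
    fix q q' \<epsilon> :: real
    assume "0 < \<epsilon>" "\<epsilon> < 1" and bound: "delta_TRL \<epsilon> \<ge> 2 powr (- (\<epsilon> powr - q))" and "q \<le> q'"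
    then have "\<epsilon> powr - q \<le> \<epsilon> powr - q'"
      by (intro powr_mono') auto
    then have "2 powr (- (\<epsilon> powr - q')) \<le> 2 powr (- (\<epsilon> powr - q))"
      by (intro powr_mono) auto
    with bound show "delta_TRL \<epsilon> \<ge> 2 powr (- (\<epsilon> powr - q'))"
      by (rule order_trans[rotated])
  qed
  then show ?thesis
    by (simp add: algebra_simps)
qed

end
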